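(* Let $\mathcal{X}\subseteq L^0_c$ be non-empty, let $f\colon\mathcal{X}\to[-\infty,\infty]$, and let $\mathcal{Q}\subseteq\mathfrak{P}_c(\Omega)$ be non-empty. There exists a $\mathcal{Q}$-localization of $f$ if and only if $f$ is $\mathcal{P}$-sensitive with reduction set $\mathcal{Q}$. In that case $f=f^{\mathcal{Q}}_E=f^{\mathcal{Q}'}_E$ for every $\mathcal{Q}'$ satisfying $\mathcal{Q}\subseteq\mathcal{Q}'\subseteq\mathfrak{P}_c(\Omega)$, i.e., $(f^Q_E)_{Q\in\mathcal{Q}'}$ is a $\mathcal{Q}'$-localization of $f$.
   Context: $(\Omega,\mathcal{F})$ is a measurable space and $\mathcal{P}$ is a non-empty set of probability measures on it; $c(A):=\sup_{P\in\mathcal{P}}P(A)$ for $A\in\mathcal{F}$. An event $A\in\mathcal{F}$ is $\mathcal{P}$-polar if $c(A)=0$; a property holds $\mathcal{P}$-q.s. if it holds outside a $\mathcal{P}$-polar event. $\mathfrak{P}_c(\Omega)$ is the set of probability measures on $(\Omega,\mathcal{F})$ vanishing on all $\mathcal{P}$-polar events. $L^0_c$ is the space of equivalence classes $[x]_c$ of real-valued random variables $x$ on $(\Omega,\mathcal{F})$ up to $\mathcal{P}$-q.s. equality. For $Q\in\mathfrak{P}_c(\Omega)$, $L^0_Q$ is the space of equivalence classes $[x]_Q$ up to $Q$-a.s. equality and $j_Q\colon L^0_c\to L^0_Q$, $[x]_c\mapsto[x]_Q$. A set $\mathcal{C}\subseteq\mathcal{X}$ is $\mathcal{P}$-sensitive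 if $\mathcal{C}=\emptyset$ or if for all $X\in\mathcal{X}$: $X\in\mathcal{C}\Leftrightarrow\forall Q\in\mathfrak{P}_c(\Omega)\colon j_Q(X)\in j_Q(\mathcal{C})$. A non-empty $\mathcal{Q}\subseteq\mathfrak{P}_c(\Omega)$ is a reduction set for $\mathcal{C}$ if for all $X\in\mathcal{X}$: $X\in\mathcal{C}\Leftrightarrow\forall Q\in\mathcal{Q}\colon j_Q(X)\in j_Q(\mathcal{C})$. The level sets of $f$ are $E_r:=\{X\in\mathcal{X}\mid f(X)\le r\}$, $r\in\mathbb{R}$. $f$ is $\mathcal{P}$-sensitive if every $E_r$, $r\in\mathbb{R}$, is $\mathcal{P}$-sensitive; $\mathcal{Q}$ is a reduction set for $f$ if it is non-empty and a reduction set for every $E_r$, $r\in\mathbb{R}$. A function $g\colon\mathcal{X}\to[-\infty,\infty]$ is $Q$-consistent if $j_Q(X)=j_Q(Y)$ implies $g(X)=g(Y)$ for $X,Y\in\mathcal{X}$. A $\mathcal{Q}$-localization of $f$ is a family $(f^Q)_{Q\in\mathcal{Q}}$ of functions $f^Q\colon\mathcal{X}\to[-\infty,\infty]$ such that each $f^Q$ is $Q$-consistent and $f(X)=\sup_{Q\in\mathcal{Q}}f^Q(X)$ for all $X\in\mathcal{X}$. For $Q\in\mathfrak{P}_c(\Omega)$, $f^Q_E\colon\mathcal{X}\to[-\infty,\infty]$ is given by $f^Q_E(X):=\inf\{r\in\mathbb{R}\mid j_Q(X)\in j_Q(E_r)\}$ (with $\inf\emptyset:=\infty$), and for non-empty $\mathcal{Q}\subseteq\mathfrak{P}_c(\Omega)$,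 $f^{\mathcal{Q}}_E(X):=\sup_{Q\in\mathcal{Q}}f^Q_E(X)$. *)

theory Defs
  imports "HOL-Probability.Probability"
begin

text \<open>Only \<open>space M\<close> and \<open>sets M\<close> matter: the measure \<open>M\<close> plays the role of the measurable
  space \<open>(\<Omega>, \<F>)\<close>.\<close>

definition prob_measures :: "'a measure \<Rightarrow> 'a measure set" where
  "prob_measures M = {P. prob_space P \<and> sets P = sets M}"

definition upper_prob :: "'a measure set \<Rightarrow> 'a set \<Rightarrow> ennreal" where
  "upper_prob \<P> A = (SUP P\<in>\<P>. emeasure P A)"

definition polar :: "'a measure \<Rightarrow> 'a measure set \<Rightarrow> 'a set \<Rightarrow> bool" where
  "polar M \<P> A \<longleftrightarrow> A \<in> sets M \<and> upper_prob \<P> A = 0"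

definition quasi_surely :: "'a measure \<Rightarrow> 'a measure set \<Rightarrow> ('a \<Rightarrow> bool) \<Rightarrow> bool" where
  "quasi_surely M \<P> \<phi> \<longleftrightarrow> (\<exists>N. polar M \<P> N \<and> (\<forall>\<omega>\<in>space M - N. \<phi> \<omega>))"

definition ac_prob_measures :: "'a measure \<Rightarrow> 'a measure set \<Rightarrow> 'a measure set" where
  "ac_prob_measures M \<P> = {Q \<in> prob_measures M. \<forall>A. polar M \<P> A \<longrightarrow> emeasure Q A = 0}"

definition qs_rel :: "'a measure \<Rightarrow> 'a measure set \<Rightarrow> (('a \<Rightarrow> real) \<times> ('a \<Rightarrow> real)) set" where
  "qs_rel M \<P> = {(x, y). x \<in> borel_measurable M \<and> y \<in> borel_measurable M \<and>
      quasi_surely M \<P> (\<lambda>\<omega>. x \<omega> = y \<omega>)}"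

definition as_rel :: "'a measure \<Rightarrow> (('a \<Rightarrow> real) \<times> ('a \<Rightarrow> real)) set" where
  "as_rel Q = {(x, y). x \<in> borel_measurable Q \<and> y \<in> borel_measurable Q \<and>
      (AE \<omega> in Q. x \<omega> = y \<omega>)}"

definition L0_c :: "'a measure \<Rightarrow> 'a measure set \<Rightarrow> ('a \<Rightarrow> real) set set" where
  "L0_c M \<P> = borel_measurable M // qs_rel M \<P>"

definition L0_Q :: "'a measure \<Rightarrow> ('a \<Rightarrow> real) set set" where
  "L0_Q Q = borel_measurable Q // as_rel Q"

text \<open>The map \<open>j\<^sub>Q\<close> sends a class \<open>X\<close> to the set of all random variables that are
  \<open>Q\<close>-almost surely equal to a member of \<open>X\<close>. For \<open>X \<in> L0_c M \<P>\<close> and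
  \<open>Q \<in> ac_prob_measures M \<P>\<close> this is the \<open>Q\<close>-class of any representative of \<open>X\<close>;
  see \<open>j_map_class\<close> below.\<close>

definition j_map :: "'a measure \<Rightarrow> ('a \<Rightarrow> real) set \<Rightarrow> ('a \<Rightarrow> real) set" where
  "j_map Q X = as_rel Q `` X"

definition sensitive_set ::
  "'a measure \<Rightarrow> 'a measure set \<Rightarrow> ('a \<Rightarrow> real) set set \<Rightarrow> ('a \<Rightarrow> real) set set \<Rightarrow> bool" where
  "sensitive_set M \<P> \<X> \<C> \<longleftrightarrow> \<C> = {} \<or>
     (\<forall>X\<in>\<X>. X \<in> \<C> \<longleftrightarrow> (\<forall>Q\<in>ac_prob_measures M \<P>. j_map Q X \<in> j_map Q ` \<C>))"

definition reduction_set ::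
  "'a measure \<Rightarrow> 'a measure set \<Rightarrow> ('a \<Rightarrow> real) set set \<Rightarrow> 'a measure set \<Rightarrow>
    ('a \<Rightarrow> real) set set \<Rightarrow> bool" where
  "reduction_set M \<P> \<X> \<Q> \<C> \<longleftrightarrow> \<Q> \<noteq> {} \<and> \<Q> \<subseteq> ac_prob_measures M \<P> \<and>
     (\<forall>X\<in>\<X>. X \<in> \<C> \<longleftrightarrow> (\<forall>Q\<in>\<Q>. j_map Q X \<in> j_map Q ` \<C>))"

text \<open>Functions \<open>\<X> \<rightarrow> [-\<infinity>, \<infinity>]\<close> are represented by total functions whose values outside
  \<open>\<X>\<close> are irrelevant.\<close>

definition level_set ::
  "('a \<Rightarrow> real) set set \<Rightarrow> (('a \<Rightarrow> real) set \<Rightarrow> ereal) \<Rightarrow> real \<Rightarrow> ('a \<Rightarrow> real) set set" where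
  "level_set \<X> f r = {X \<in> \<X>. f X \<le> ereal r}"

definition sensitive_fun ::
  "'a measure \<Rightarrow> 'a measure set \<Rightarrow> ('a \<Rightarrow> real) set set \<Rightarrow> (('a \<Rightarrow> real) set \<Rightarrow> ereal) \<Rightarrow> bool" where
  "sensitive_fun M \<P> \<X> f \<longleftrightarrow> (\<forall>r. sensitive_set M \<P> \<X> (level_set \<X> f r))"

definition reduction_set_fun ::
  "'a measure \<Rightarrow> 'a measure set \<Rightarrow> ('a \<Rightarrow> real) set set \<Rightarrow> 'a measure set \<Rightarrow>
    (('a \<Rightarrow> real) set \<Rightarrow> ereal) \<Rightarrow> bool" where
  "reduction_set_fun M \<P> \<X> \<Q> f \<longleftrightarrow>
     \<Q> \<noteq> {} \<and> (\<forall>r. reduction_set M \<P> \<X> \<Q> (level_set \<X> f r))"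

definition consistent ::
  "('a \<Rightarrow> real) set set \<Rightarrow> 'a measure \<Rightarrow> (('a \<Rightarrow> real) set \<Rightarrow> ereal) \<Rightarrow> bool" where
  "consistent \<X> Q g \<longleftrightarrow> (\<forall>X\<in>\<X>. \<forall>Y\<in>\<X>. j_map Q X = j_map Q Y \<longrightarrow> g X = g Y)"

definition localization ::
  "('a \<Rightarrow> real) set set \<Rightarrow> 'a measure set \<Rightarrow> (('a \<Rightarrow> real) set \<Rightarrow> ereal) \<Rightarrow>
    ('a measure \<Rightarrow> ('a \<Rightarrow> real) set \<Rightarrow> ereal) \<Rightarrow> bool" where
  "localization \<X> \<Q> f F \<longleftrightarrow>
     (\<forall>Q\<in>\<Q>. consistent \<X> Q (F Q)) \<and> (\<forall>X\<in>\<X>. f X = (SUP Q\<in>\<Q>. F Q X))"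

text \<open>In \<^typ>\<open>ereal\<close> the infimum of the empty set is \<open>\<infinity>\<close>.\<close>

definition loc_E ::
  "('a \<Rightarrow> real) set set \<Rightarrow> (('a \<Rightarrow> real) set \<Rightarrow> ereal) \<Rightarrow> 'a measure \<Rightarrow>
    ('a \<Rightarrow> real) set \<Rightarrow> ereal" where
  "loc_E \<X> f Q X = Inf {ereal r | r. j_map Q X \<in> j_map Q ` level_set \<X> f r}"

definition sup_loc_E ::
  "('a \<Rightarrow> real) set set \<Rightarrow> (('a \<Rightarrow> real) set \<Rightarrow> ereal) \<Rightarrow> 'a measure set \<Rightarrow>
    ('a \<Rightarrow> real) set \<Rightarrow> ereal" where
  "sup_loc_E \<X> f \<Q> X = (SUP Q\<in>\<Q>. loc_E \<X> f Q X)"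

lemma polar_iff: "polar M \<P> A \<longleftrightarrow> A \<in> sets M \<and> (\<forall>P\<in>\<P>. emeasure P A = 0)"
  by (auto simp: polar_def upper_prob_def SUP_eq_iff bot_ennreal[symmetric])

lemma polar_empty: "polar M \<P> {}"
  by (simp add: polar_iff)

lemma polar_Un:
  assumes "\<P> \<subseteq> prob_measures M" "polar M \<P> A" "polar M \<P> B"
  shows "polar M \<P> (A \<union> B)"
proof -
  have "emeasure P (A \<union> B) = 0" if "P \<in> \<P>" for P
  proof -
    have "A \<in> null_sets P" "B \<in> null_sets P"
      using assms that by (auto simp: polar_iff prob_measures_def null_sets_def)
    then show ?thesis
      by (metis null_sets.Un null_setsD1)
  qed
  then show ?thesis
    using assms by (auto simp: polar_iff)
qed

lemma equiv_qs_rel: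
  assumes "\<P> \<subseteq> prob_measures M"
  shows "equiv (borel_measurable M) (qs_rel M \<P>)"
proof (rule equivI)
  show "qs_rel M \<P> \<subseteq> borel_measurable M \<times> borel_measurable M"
    by (auto simp: qs_rel_def)
  show "refl_on (borel_measurable M) (qs_rel M \<P>)"
    by (auto simp: refl_on_def qs_rel_def quasi_surely_def intro: polar_empty)
  show "sym (qs_rel M \<P>)"
    unfolding sym_def qs_rel_def quasi_surely_def by auto
  show "trans (qs_rel M \<P>)"
  proof (rule transI)
    fix x y z assume xy: "(x, y) \<in> qs_rel M \<P>" and yz: "(y, z) \<in> qs_rel M \<P>"
    obtain A where A: "polar M \<P> A" "\<forall>\<omega>\<in>space M - A. x \<omega> = y \<omega>"
      using xy by (auto simp: qs_rel_def quasi_surely_def)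
    obtain B where B: "polar M \<P> B" "\<forall>\<omega>\<in>space M - B. y \<omega> = z \<omega>"
      using yz by (auto simp: qs_rel_def quasi_surely_def)
    have "polar M \<P> (A \<union> B)" "\<forall>\<omega>\<in>space M - (A \<union> B). x \<omega> = z \<omega>"
      using A B polar_Un[OF assms] by auto
    then show "(x, z) \<in> qs_rel M \<P>"
      using xy yz unfolding qs_rel_def quasi_surely_def by blast
  qed
qed

lemma equiv_as_rel: "equiv (borel_measurable Q) (as_rel Q)"
proof (rule equivI)
  show "as_rel Q \<subseteq> borel_measurable Q \<times> borel_measurable Q"
    by (auto simp: as_rel_def)
  show "refl_on (borel_measurable Q) (as_rel Q)"
    by (auto simp: refl_on_def as_rel_def)
  show "sym (as_rel Q)"
    by (auto simp: sym_def as_rel_def elim: eventually_mono)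
  show "trans (as_rel Q)"
    by (rule transI) (auto simp: as_rel_def elim: eventually_elim2)
qed

lemma qs_rel_subset_as_rel:
  assumes "Q \<in> ac_prob_measures M \<P>"
  shows "qs_rel M \<P> \<subseteq> as_rel Q"
proof (rule subrelI)
  fix x y assume xy: "(x, y) \<in> qs_rel M \<P>"
  have Q: "sets Q = sets M" "\<And>A. polar M \<P> A \<Longrightarrow> emeasure Q A = 0"
    using assms by (auto simp: ac_prob_measures_def prob_measures_def)
  obtain N where N: "polar M \<P> N" "\<forall>\<omega>\<in>space M - N. x \<omega> = y \<omega>"
    using xy by (auto simp: qs_rel_def quasi_surely_def)
  have "N \<in> null_sets Q"
    using N(1) Q by (auto simp: null_sets_def polar_def)
  moreover have "{\<omega>\<in>space Q. x \<omega> \<noteq> y \<omega>} \<subseteq> N"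
    using N(2) sets_eq_imp_space_eq[OF Q(1)] by auto
  ultimately have "AE \<omega> in Q. x \<omega> = y \<omega>"
    by (rule AE_I')
  then show "(x, y) \<in> as_rel Q"
    using xy measurable_cong_sets[OF Q(1), of borel borel] by (auto simp: qs_rel_def as_rel_def)
qed

lemma j_map_class:
  assumes "\<P> \<subseteq> prob_measures M" "Q \<in> ac_prob_measures M \<P>" "x \<in> borel_measurable M"
  shows "j_map Q (qs_rel M \<P> `` {x}) = as_rel Q `` {x}"
proof -
  have "(x, x) \<in> qs_rel M \<P>"
    using equiv_qs_rel[OF assms(1)] assms(3) by (auto dest: equivE refl_onD)
  moreover have "trans (as_rel Q)"
    using equiv_as_rel by (rule equivE)
  ultimately show ?thesis
    using qs_rel_subset_as_rel[OF assms(2)] unfolding j_map_def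
    by (blast dest: transD)
qed

lemma j_map_in_L0_Q:
  assumes "\<P> \<subseteq> prob_measures M" "Q \<in> ac_prob_measures M \<P>" "X \<in> L0_c M \<P>"
  shows "j_map Q X \<in> L0_Q Q"
proof -
  obtain x where x: "x \<in> borel_measurable M" "X = qs_rel M \<P> `` {x}"
    using assms(3) by (auto simp: L0_c_def elim: quotientE)
  have "x \<in> borel_measurable Q"
    using x(1) assms(2) measurable_cong_sets[of Q M borel borel]
    by (auto simp: ac_prob_measures_def prob_measures_def)
  then show ?thesis
    using j_map_class[OF assms(1,2) x(1)] x(2) by (auto simp: L0_Q_def intro: quotientI)
qed

end

theory Submission
  imports Defs
begin

text \<open>
  For each \<open>Q\<close>, the function \<open>loc_E \<X> f Q\<close> is the greatest \<open>Q\<close>-consistent minorant of \<open>f\<close> on \<open>\<X>\<close>: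
  it equals \<open>inf {f Y | Y \<in> \<X>, j\<^sub>Q(Y) = j\<^sub>Q(X)}\<close>, which is how one forces a function to depend on \<open>j\<^sub>Q(X)\<close>
  alone without exceeding \<open>f\<close> (lemmas \<open>loc_E_consistent\<close>, \<open>loc_E_le\<close>, \<open>le_loc_E\<close>). Since the members
  of a localization are consistent minorants of \<open>f\<close> whose supremum is \<open>f\<close>, some localization over
  \<open>\<Q>\<close> exists exactly if the canonical family \<open>loc_E\<close> is one. Moreover, replacing \<open>\<Q>\<close> by
  a larger \<open>\<Q>'\<close> only adds further minorants of \<open>f\<close> to a supremum that already equals \<open>f\<close>.

  It remains to translate this into level sets. If \<open>F\<close> is a localization and, for every
  \<open>Q \<in> \<Q>\<close>, \<open>X\<close> looks under \<open>Q\<close> like some \<open>Y\<close> with \<open>f Y \<le> r\<close>, then consistency gives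
  \<open>F Q X = F Q Y \<le> f Y \<le> r\<close> for all \<open>Q\<close>, hence \<open>f X \<le> r\<close>; thus \<open>\<Q>\<close> is a reduction set for every
  level set. Conversely, if \<open>\<Q>\<close> is a reduction set and \<open>sup\<^sub>Q loc_E \<X> f Q X < r\<close>, then every
  \<open>Q \<in> \<Q>\<close> sees \<open>X\<close> as an element of the \<open>r\<close>-level set, so \<open>f X \<le> r\<close>. Sensitivity comes
  for free because a reduction set may be enlarged to the set of all probability measures
  that vanish on polar events.
\<close>

lemma level_set_mono: "r \<le> s \<Longrightarrow> level_set \<X> f r \<subseteq> level_set \<X> f s"
  unfolding level_set_def using order_trans[of _ "ereal r" "ereal s"] by auto

lemma loc_E_consistent: "consistent \<X> Q (loc_E \<X> f Q)"
  by (simp add: consistent_def loc_E_def)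

lemma loc_E_le:
  assumes "X \<in> \<X>"
  shows "loc_E \<X> f Q X \<le> f X"
proof (rule ereal_le_real)
  fix r assume "f X \<le> ereal r"
  then have "X \<in> level_set \<X> f r"
    using assms by (simp add: level_set_def)
  then show "loc_E \<X> f Q X \<le> ereal r"
    unfolding loc_E_def by (intro Inf_lower) blast
qed

text \<open>Every \<open>r\<close> in the set defining \<open>loc_E\<close> is witnessed by some \<open>Y\<close> that \<open>Q\<close> cannot distinguish
  from \<open>X\<close>, so a consistent minorant \<open>g\<close> satisfies \<open>g X = g Y \<le> f Y \<le> r\<close>.\<close>

lemma le_loc_E:
  assumes "consistent \<X> Q g" and "\<And>Y. Y \<in> \<X> \<Longrightarrow> g Y \<le> f Y" and "X \<in> \<X>"
  shows "g X \<le> loc_E \<X> f Q X"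
  unfolding loc_E_def
proof (rule Inf_greatest)
  fix u assume "u \<in> {ereal r | r. j_map Q X \<in> j_map Q ` level_set \<X> f r}"
  then obtain r Y where u: "u = ereal r" and Y: "Y \<in> \<X>" "f Y \<le> ereal r" "j_map Q X = j_map Q Y"
    by (auto simp: level_set_def)
  have "g X = g Y"
    using assms(1,3) Y unfolding consistent_def by blast
  also have "\<dots> \<le> f Y"
    using assms(2) Y by blast
  also have "\<dots> \<le> u"
    using u Y(2) by simp
  finally show "g X \<le> u" .
qed

lemma localization_le:
  assumes "localization \<X> \<Q> f F" "Q \<in> \<Q>" "X \<in> \<X>"
  shows "F Q X \<le> f X"
  using SUP_upper[OF assms(2), of "\<lambda>Q. F Q X"] assms(1,3) by (simp add: localization_def)

lemma localization_loc_E_superset: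
  assumes F: "localization \<X> \<Q> f F" and sub: "\<Q> \<subseteq> \<Q>'"
  shows "localization \<X> \<Q>' f (loc_E \<X> f)"
proof -
  have "f X = (SUP Q\<in>\<Q>'. loc_E \<X> f Q X)" if X: "X \<in> \<X>" for X
  proof (rule antisym)
    have "F Q X \<le> loc_E \<X> f Q X" if "Q \<in> \<Q>" for Q
      using F that X by (intro le_loc_E localization_le[OF F]) (auto simp: localization_def)
    then have "(SUP Q\<in>\<Q>. F Q X) \<le> (SUP Q\<in>\<Q>'. loc_E \<X> f Q X)"
      using sub by (intro SUP_mono) blast
    then show "f X \<le> (SUP Q\<in>\<Q>'. loc_E \<X> f Q X)"
      using F X by (simp add: localization_def)
    show "(SUP Q\<in>\<Q>'. loc_E \<X> f Q X) \<le> f X"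
      using X by (intro SUP_least loc_E_le)
  qed
  then show ?thesis
    by (simp add: localization_def loc_E_consistent)
qed

lemma localization_sup_loc_E:
  assumes "localization \<X> \<Q> f (loc_E \<X> f)" "X \<in> \<X>"
  shows "f X = sup_loc_E \<X> f \<Q> X"
  using assms by (simp add: localization_def sup_loc_E_def)

lemma reduction_set_superset:
  assumes "reduction_set M \<P> \<X> \<Q> \<C>" "\<Q> \<subseteq> \<Q>'" "\<Q>' \<subseteq> ac_prob_measures M \<P>"
  shows "reduction_set M \<P> \<X> \<Q>' \<C>"
  using assms unfolding reduction_set_def by blast

lemma reduction_set_imp_sensitive_set:
  assumes "reduction_set M \<P> \<X> \<Q> \<C>"
  shows "sensitive_set M \<P> \<X> \<C>"
proof -
  have "reduction_set M \<P> \<X> (ac_prob_measures M \<P>) \<C>"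
    using assms by (rule reduction_set_superset) (use assms in \<open>auto simp: reduction_set_def\<close>)
  then show ?thesis
    by (simp add: reduction_set_def sensitive_set_def)
qed

lemma localization_imp_reduction_set:
  assumes F: "localization \<X> \<Q> f F" and "\<Q> \<noteq> {}" "\<Q> \<subseteq> ac_prob_measures M \<P>"
  shows "reduction_set M \<P> \<X> \<Q> (level_set \<X> f r)"
proof -
  have "X \<in> level_set \<X> f r"
    if X: "X \<in> \<X>" and j: "\<forall>Q\<in>\<Q>. j_map Q X \<in> j_map Q ` level_set \<X> f r" for X
  proof -
    have "F Q X \<le> ereal r" if Q: "Q \<in> \<Q>" for Q
    proof -
      obtain Y where Y: "Y \<in> \<X>" "f Y \<le> ereal r" "j_map Q X = j_map Q Y"
        using j Q by (auto simp: level_set_def)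
      have "F Q X = F Q Y"
        using F Q X Y unfolding localization_def consistent_def by blast
      also have "\<dots> \<le> f Y"
        using localization_le[OF F Q Y(1)] .
      also note \<open>f Y \<le> ereal r\<close>
      finally show ?thesis .
    qed
    then have "(SUP Q\<in>\<Q>. F Q X) \<le> ereal r"
      by (rule SUP_least)
    then show ?thesis
      using F X by (simp add: localization_def level_set_def)
  qed
  then show ?thesis
    using assms(2,3) by (auto simp: reduction_set_def)
qed

text \<open>The infimum defining \<open>loc_E\<close> need not be attained. The argument therefore starts from a real
  \<open>r\<close> strictly above the supremum: for each \<open>Q\<close> some level \<open>s < r\<close> then belongs to the set whose
  infimum is taken, and the \<open>s\<close>-level set is contained in the \<open>r\<close>-level set.\<close>

lemma reduction_set_imp_localization_loc_E:
  assumes red: "\<And>r. reduction_set M \<P> \<X> \<Q> (level_set \<X> f r)"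
  shows "localization \<X> \<Q> f (loc_E \<X> f)"
proof -
  have "f X = (SUP Q\<in>\<Q>. loc_E \<X> f Q X)" if X: "X \<in> \<X>" for X
  proof (rule antisym)
    show "(SUP Q\<in>\<Q>. loc_E \<X> f Q X) \<le> f X"
      using X by (intro SUP_least loc_E_le)
    show "f X \<le> (SUP Q\<in>\<Q>. loc_E \<X> f Q X)"
    proof (rule ccontr)
      assume "\<not> f X \<le> (SUP Q\<in>\<Q>. loc_E \<X> f Q X)"
      then obtain r where r: "(SUP Q\<in>\<Q>. loc_E \<X> f Q X) < ereal r" "ereal r < f X"
        unfolding not_le by (blast dest: ereal_dense2)
      have "j_map Q X \<in> j_map Q ` level_set \<X> f r" if "Q \<in> \<Q>" for Q
      proof -
        have "loc_E \<X> f Q X < ereal r"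
          using SUP_upper[OF that] r(1) by (rule le_less_trans)
        then obtain s where "s < r" "j_map Q X \<in> j_map Q ` level_set \<X> f s"
          by (auto simp: loc_E_def Inf_less_iff)
        then show ?thesis
          using level_set_mono[of s r \<X> f] by auto
      qed
      then have "X \<in> level_set \<X> f r"
        using red X by (auto simp: reduction_set_def)
      then show False
        using r(2) by (simp add: level_set_def not_less[symmetric])
    qed
  qed
  then show ?thesis
    by (simp add: localization_def loc_E_consistent)
qed

theorem theorem3p2:
  fixes M :: "'a measure"
    and \<P> \<Q> :: "'a measure set"
    and \<X> :: "('a \<Rightarrow> real) set set"
    and f :: "('a \<Rightarrow> real) set \<Rightarrow> ereal"
  assumes "\<P> \<noteq> {}" and "\<P> \<subseteq> prob_measures M"
    and "\<X> \<noteq> {}" and "\<X> \<subseteq> L0_c M \<P>"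
    and "\<Q> \<noteq> {}" and "\<Q> \<subseteq> ac_prob_measures M \<P>"
  shows "((\<exists>F. localization \<X> \<Q> f F) \<longleftrightarrow>
            sensitive_fun M \<P> \<X> f \<and> reduction_set_fun M \<P> \<X> \<Q> f) \<and>
         ((\<exists>F. localization \<X> \<Q> f F) \<longrightarrow>
            (\<forall>\<Q>'. \<Q> \<subseteq> \<Q>' \<and> \<Q>' \<subseteq> ac_prob_measures M \<P> \<longrightarrow>
               (\<forall>X\<in>\<X>. f X = sup_loc_E \<X> f \<Q> X \<and> f X = sup_loc_E \<X> f \<Q>' X) \<and>
               localization \<X> \<Q>' f (loc_E \<X> f)))"
proof (intro conjI iffI impI allI ballI)
  assume "\<exists>F. localization \<X> \<Q> f F"
  then have red: "reduction_set M \<P> \<X> \<Q> (level_set \<X> f r)" for r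
    using localization_imp_reduction_set assms(5,6) by blast
  show "sensitive_fun M \<P> \<X> f"
    using reduction_set_imp_sensitive_set[OF red] by (simp add: sensitive_fun_def)
  show "reduction_set_fun M \<P> \<X> \<Q> f"
    using red assms(5) by (simp add: reduction_set_fun_def)
next
  assume "sensitive_fun M \<P> \<X> f \<and> reduction_set_fun M \<P> \<X> \<Q> f"
  then have "localization \<X> \<Q> f (loc_E \<X> f)"
    by (intro reduction_set_imp_localization_loc_E) (auto simp: reduction_set_fun_def)
  then show "\<exists>F. localization \<X> \<Q> f F"
    by blast
next
  fix \<Q>' assume "\<exists>F. localization \<X> \<Q> f F" and "\<Q> \<subseteq> \<Q>' \<and> \<Q>' \<subseteq> ac_prob_measures M \<P>"
  then have loc: "localization \<X> \<Q> f (loc_E \<X> f)" "localization \<X> \<Q>' f (loc_E \<X> f)"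
    by (auto intro: localization_loc_E_superset)
  show "localization \<X> \<Q>' f (loc_E \<X> f)"
    by (fact loc(2))
  fix X assume X: "X \<in> \<X>"
  show "f X = sup_loc_E \<X> f \<Q> X"
    using loc(1) X by (rule localization_sup_loc_E)
  show "f X = sup_loc_E \<X> f \<Q>' X"
    using loc(2) X by (rule localization_sup_loc_E)
qed

end
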